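(* For $n \geq 1$ let $H_n(p,q) := \sum_{w \in S_n} p^{\mathrm{inv}(w)} q^{\mathrm{maj}(w)}$, let $F_n(p,q) := \dfrac{n!\, H_n(p,q)}{[n]_p!\,[n]_q!}$ (a rational function in $p,q$), and let $\sigma_n > 0$ be given by $\sigma_n^2 = \dfrac{2n^3+3n^2-5n}{72}$. Then, uniformly for $(s,t)$ in compact subsets of $\mathbb{R}^2$, \[ F_n\big(e^{is/\sigma_n}, e^{it/\sigma_n}\big) \to 1 \qquad \text{as } n \to \infty. \]
   Context: For a permutation $w = w_1\cdots w_n \in S_n$, $\mathrm{inv}(w) := \#\{i<j : w_i > w_j\}$ and $\mathrm{maj}(w) := \sum_{1 \le i \le n-1,\ w_i > w_{i+1}} i$. For a positive integer $c$, $[c]_p := 1 + p + \cdots + p^{c-1}$, and $[n]_p! := [n]_p [n-1]_p \cdots [1]_p$. The quantity $\sigma_n^2$ is the common variance of $\mathrm{inv}$ and $\mathrm{maj}$ on the uniformly random permutation in $S_n$. (For fixed compact set and $n$ large, the denominators $[c]_{e^{is/\sigma_n}}$, $1 \le c \le n$, are nonzero, so the evaluation makes sense.) *)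

theory Defs
  imports "HOL-Analysis.Analysis" "HOL-Combinatorics.Permutations"
begin

text \<open>A permutation \<open>w\<close> in $S_n$ is a function \<open>w\<close> with \<open>w permutes {1..n}\<close>; its
  one-line notation is \<open>w 1, \<dots>, w n\<close>.\<close>

definition perm_inv :: "nat \<Rightarrow> (nat \<Rightarrow> nat) \<Rightarrow> nat" where
  "perm_inv n w = card {(i, j). i \<in> {1..n} \<and> j \<in> {1..n} \<and> i < j \<and> w i > w j}"

definition perm_maj :: "nat \<Rightarrow> (nat \<Rightarrow> nat) \<Rightarrow> nat" where
  "perm_maj n w = (\<Sum>i \<in> {i. 1 \<le> i \<and> i < n \<and> w i > w (i + 1)}. i)"

definition q_bracket :: "nat \<Rightarrow> complex \<Rightarrow> complex" where
  "q_bracket c p = (\<Sum>k<c. p ^ k)"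

definition q_fact :: "nat \<Rightarrow> complex \<Rightarrow> complex" where
  "q_fact n p = (\<Prod>c=1..n. q_bracket c p)"

definition H :: "nat \<Rightarrow> complex \<Rightarrow> complex \<Rightarrow> complex" where
  "H n p q = (\<Sum>w | w permutes {1..n}. p ^ perm_inv n w * q ^ perm_maj n w)"

text \<open>The rational function is evaluated pointwise. Where a denominator vanishes the value is
  \<open>0\<close> by the convention \<open>x / 0 = 0\<close>; hence a uniform limit \<open>1\<close> can only hold if the
  denominators are eventually nonzero on the whole set considered.\<close>

definition F :: "nat \<Rightarrow> complex \<Rightarrow> complex \<Rightarrow> complex" where
  "F n p q = fact n * H n p q / (q_fact n p * q_fact n q)"

text \<open>The common standard deviation $\sigma_n$ of \<open>perm_inv n\<close> and \<open>perm_maj n\<close> on a uniformly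
  random permutation. The radicand is nonnegative for every \<open>n\<close> and vanishes for \<open>n \<le> 1\<close>, which is
  irrelevant for the limit.\<close>

definition stddev :: "nat \<Rightarrow> real" where
  "stddev n = sqrt ((2 * real n ^ 3 + 3 * real n ^ 2 - 5 * real n) / 72)"

end

theory Submission
  imports Defs "HOL-Combinatorics.Multiset_Permutations" "HOL-Computational_Algebra.Formal_Power_Series"
    "HOL-Real_Asymp.Real_Asymp"
begin

text \<open>
  Dividing \<open>H\<close> by the \<open>q\<close>-Pochhammer symbols gives \<open>h\<^sub>n\<close>, the complete homogeneous symmetric function
  at the variables $p^a q^b$ (Roselle). It is identified here without infinite products: splitting
  off an increasing run at the end of a word gives a recursion which says that
  $g(z) = \sum_n h_n z^n$ satisfies $g(z) = e(z)\, g(qz)$ with $e(z) = \sum_n z^n / (p)_n$. Taking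
  logarithmic derivatives yields Newton's recursion
  $n h_n = \sum_{k=1}^n h_{n-k} / ((1-p^k)(1-q^k))$, that is, with $a = (1-p)(1-q)$,
  \[ F_n = \sum_{k=1}^n \frac{(n-1)!}{(n-k)!} \, \frac{a^{k-1}}{[k]_p [k]_q} \, F_{n-k}. \]
  It extends to the unit circle by continuity. There $a = O(n^{-3})$, and $|[k]_p|, |[k]_q| \ge k/2$
  for $k \le n$, so the terms with $k \ge 2$ change $F$ by $O(n |a|)$ in each of the \<open>n\<close> steps.
\<close>

section \<open>Inversions, descents and the initial decreasing run of a reversed word\<close>

text \<open>Words are stored in reverse, last letter first, so that \<open>rinv\<close> and \<open>rmaj\<close> are the inversion
  number and the major index of the reversed list.\<close>

primrec rinv :: "'a::linorder list \<Rightarrow> nat" where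
  "rinv [] = 0"
| "rinv (x # xs) = card {y \<in> set xs. x < y} + rinv xs"

fun rmaj :: "'a::linorder list \<Rightarrow> nat" where
  "rmaj [] = 0"
| "rmaj [x] = 0"
| "rmaj (x # y # xs) = (if x < y then Suc (length xs) else 0) + rmaj (y # xs)"

text \<open>The weights are chosen such that the sum over the prefixes of the initial decreasing run
  telescopes.\<close>

lemma initial_run_sum:
  fixes q :: "'b::comm_ring_1"
  assumes "distinct w" "w \<noteq> []"
  shows "(\<Sum>i<length w. if sorted_wrt (>) (take (Suc i) w)
            then q ^ (length w - Suc i) * (\<Prod>j<i. 1 - q ^ (length w - Suc j)) * q ^ rmaj (drop (Suc i) w)
            else 0) = q ^ rmaj w"
  using assms
proof (induction w rule: rmaj.induct)
  case 1
  then show ?case by simp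
next
  case (2 x)
  then show ?case by simp
next
  case (3 x y xs)
  let ?w = "y # xs"
  let ?n = "length ?w"
  let ?f = "\<lambda>i. if sorted_wrt (>) (take (Suc i) ?w)
            then q ^ (?n - Suc i) * (\<Prod>j<i. 1 - q ^ (?n - Suc j)) * q ^ rmaj (drop (Suc i) ?w)
            else 0"
  let ?g = "\<lambda>i. if sorted_wrt (>) (take (Suc i) (x # ?w))
            then q ^ (length (x # ?w) - Suc i) * (\<Prod>j<i. 1 - q ^ (length (x # ?w) - Suc j)) * q ^ rmaj (drop (Suc i) (x # ?w))
            else 0"
  have IH: "(\<Sum>i<?n. ?f i) = q ^ rmaj ?w"
    using 3 by simp
  have tr: "transp ((>) :: 'a \<Rightarrow> 'a \<Rightarrow> bool)" by (auto simp: transp_def)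
  \<comment> \<open>A decreasing prefix of length at least 2 of \<open>x # ?w\<close> needs
    \<open>y < x\<close>; removing \<open>x\<close> then leaves term \<open>i\<close> for
    \<open>?w\<close>, up to the new factor \<open>1 - q ^ ?n\<close> at
    \<open>j = 0\<close>.\<close>
  have step: "?g (Suc i) = (if y < x then (1 - q ^ ?n) * ?f i else 0)" for i
  proof -
    have "sorted_wrt (>) (take (Suc (Suc i)) (x # ?w)) \<longleftrightarrow> y < x \<and> sorted_wrt (>) (take (Suc i) ?w)"
      using sorted_wrt2[OF tr, of x y "take i xs"] by simp
    moreover have "(\<Prod>j<Suc i. 1 - q ^ (length (x # ?w) - Suc j))
        = (1 - q ^ ?n) * (\<Prod>j<i. 1 - q ^ (?n - Suc j))"
      by (subst prod.lessThan_Suc_shift) simp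
    ultimately show ?thesis by (simp add: mult_ac)
  qed
  have "(\<Sum>i<length (x # ?w). ?g i) = ?g 0 + (\<Sum>i<?n. ?g (Suc i))"
    by (simp only: list.size(4) add_Suc_right add_0_right sum.lessThan_Suc_shift)
  also have "?g 0 = q ^ ?n * q ^ rmaj ?w" by simp
  also have "(\<Sum>i<?n. ?g (Suc i)) = (if y < x then (1 - q ^ ?n) * q ^ rmaj ?w else 0)"
    unfolding step IH[symmetric] sum_distrib_left by (cases "y < x") (simp_all only: if_True if_False sum.neutral_const)
  \<comment> \<open>If \<open>y < x\<close>, the weights \<open>q ^ ?n\<close> and
    \<open>1 - q ^ ?n\<close> add up to 1. If \<open>x < y\<close>, only \<open>q ^ ?n\<close>
    survives, and this is the contribution of the descent at position \<open>?n\<close>.\<close>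
  also have "q ^ ?n * q ^ rmaj ?w + \<dots> = q ^ rmaj (x # ?w)"
    using 3 by (auto simp: power_add algebra_simps)
  finally show ?case .
qed

abbreviation cross :: "'a::linorder set \<Rightarrow> 'a set \<Rightarrow> nat" where
  "cross B A \<equiv> card {(x, y). x \<in> B \<and> y \<in> A \<and> y < x}"

text \<open>No letter of a decreasing \<open>v\<close> is followed within \<open>v\<close> by a
  larger one, so every pair counted for a letter of \<open>v\<close> has its larger entry in
  \<open>u\<close>.\<close>

lemma rinv_append_decreasing:
  assumes "sorted_wrt (>) v"
  shows "rinv (v @ u) = cross (set u) (set v) + rinv u"
  using assms
proof (induction v)
  case Nil
  then show ?case by simp
next
  case (Cons a v)
  have fin: "finite {(x, y). x \<in> set u \<and> y \<in> B \<and> y < x}" if "finite B" for B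
    by (rule finite_subset[of _ "set u \<times> B"]) (use that in auto)
  have "{(x, y). x \<in> set u \<and> y \<in> set (a # v) \<and> y < x}
      = (\<lambda>x. (x, a)) ` {x \<in> set u. a < x} \<union> {(x, y). x \<in> set u \<and> y \<in> set v \<and> y < x}"
    by auto
  moreover have "card \<dots> = card {x \<in> set u. a < x} + cross (set u) (set v)"
    using Cons.prems
    by (subst card_Un_disjoint) (auto simp: fin card_image inj_on_def)
  moreover have "{y \<in> set (v @ u). a < y} = {x \<in> set u. a < x}"
    using Cons.prems by auto
  ultimately show ?case using Cons by simp
qed

section \<open>q-Pochhammer symbols and Gaussian binomial coefficients\<close>

definition qpoch :: "'b::comm_ring_1 \<Rightarrow> nat \<Rightarrow> 'b" where
  "qpoch p n = (\<Prod>c=1..n. 1 - p ^ c)"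

lemma qpoch_0 [simp]: "qpoch p 0 = 1" by (simp add: qpoch_def)

lemma qpoch_Suc: "qpoch p (Suc n) = qpoch p n * (1 - p ^ Suc n)"
  by (simp add: qpoch_def)

lemma qpoch_diff:
  assumes "i \<le> n"
  shows "(\<Prod>j<i. 1 - p ^ (n - j)) * qpoch p (n - i) = qpoch p n"
  using assms
proof (induction i)
  case (Suc i)
  then have "n - i = Suc (n - Suc i)" by simp
  then show ?case using Suc qpoch_Suc[of p "n - Suc i"] by (simp add: mult_ac)
qed simp

text \<open>The sum is the Gaussian binomial coefficient, and the identity is its product formula
  with denominators cleared. Adding a new maximum \<open>b\<close> gives the q-Pascal rule: if
  \<open>b\<close> lies in the subset, no pair arises; if it lies in the complement, it forms a pair
  with each element of the subset.\<close>

lemma q_binomial_subsets: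
  fixes p :: "'b::comm_ring_1" and X :: "'a::linorder set"
  assumes "finite X" "k \<le> card X"
  shows "(\<Sum>A | A \<subseteq> X \<and> card A = k. p ^ cross (X - A) A) * qpoch p k * qpoch p (card X - k) = qpoch p (card X)"
  using assms
proof (induction X arbitrary: k rule: finite_linorder_max_induct)
  case empty
  have "{A :: 'a set. A = {} \<and> card A = k} = {{}}" using empty by auto
  with empty show ?case by simp
next
  case (insert b X)
  let ?S = "\<lambda>X k. \<Sum>A | A \<subseteq> X \<and> card A = k. p ^ cross (X - A) A"
  have bX: "b \<notin> X" using insert by auto
  have fin: "finite {(x, y). x \<in> C \<and> y \<in> B \<and> y < x}" if "finite B" "finite C" for B C :: "'a set"
    by (rule finite_subset[of _ "C \<times> B"]) (use that in auto)
  show ?case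
  proof (cases k)
    case 0
    have "{A. A \<subseteq> insert b X \<and> card A = k} = {{}}"
      using 0 insert.hyps finite_subset[of _ "insert b X"] by auto
    with 0 show ?thesis by simp
  next
    case (Suc l)
    have c1: "cross (insert b X - insert b A) (insert b A) = cross (X - A) A" if "A \<subseteq> X" for A
    proof -
      have "{(x, y). x \<in> insert b X - insert b A \<and> y \<in> insert b A \<and> y < x}
         = {(x, y). x \<in> X - A \<and> y \<in> A \<and> y < x}"
        using insert.hyps(2) bX by force
      then show ?thesis by simp
    qed
    have c2: "cross (insert b X - A) A = card A + cross (X - A) A" if "A \<subseteq> X" for A
    proof -
      have "{(x, y). x \<in> insert b X - A \<and> y \<in> A \<and> y < x}
         = Pair b ` A \<union> {(x, y). x \<in> X - A \<and> y \<in> A \<and> y < x}"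
        using insert.hyps(2) bX that by auto
      also have "card \<dots> = card A + cross (X - A) A"
        using that insert.hyps(1) bX finite_subset[OF that] fin[of A "X - A"]
        by (subst card_Un_disjoint) (auto simp: card_image inj_on_def)
      finally show ?thesis .
    qed
    have split: "{A. A \<subseteq> insert b X \<and> card A = Suc l}
      = insert b ` {A. A \<subseteq> X \<and> card A = l} \<union> {A. A \<subseteq> X \<and> card A = Suc l}" (is "?L = ?R")
    proof
      show "?L \<subseteq> ?R"
      proof
        fix A assume A: "A \<in> ?L"
        show "A \<in> ?R"
        proof (cases "b \<in> A")
          case True
          then have "A = insert b (A - {b})" "A - {b} \<subseteq> X" "card (A - {b}) = l"
            using A finite_subset[of A "insert b X"] insert.hyps(1) by (auto simp: card_Diff_singleton)
          then show ?thesis by blast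
        qed (use A in auto)
      qed
      show "?R \<subseteq> ?L"
      proof -
        have "card (insert b A) = Suc (card A)" if "A \<subseteq> X" for A
          using that bX finite_subset[OF that insert.hyps(1)] by (intro card_insert_disjoint) auto
        then show ?thesis by auto
      qed
    qed
    have inj: "inj_on (insert b) {A. A \<subseteq> X \<and> card A = l}"
      using bX by (auto simp: inj_on_def)
    have rec: "?S (insert b X) (Suc l) = ?S X l + p ^ Suc l * ?S X (Suc l)"
    proof -
      have "?S (insert b X) (Suc l)
        = (\<Sum>A\<in>insert b ` {A. A \<subseteq> X \<and> card A = l}. p ^ cross (insert b X - A) A)
          + (\<Sum>A | A \<subseteq> X \<and> card A = Suc l. p ^ cross (insert b X - A) A)"
        unfolding split using bX insert.hyps(1) by (intro sum.union_disjoint) auto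
      also have "(\<Sum>A\<in>insert b ` {A. A \<subseteq> X \<and> card A = l}. p ^ cross (insert b X - A) A) = ?S X l"
        unfolding sum.reindex[OF inj] o_def using c1 by (intro sum.cong) (simp_all only: mem_Collect_eq)
      also have "(\<Sum>A | A \<subseteq> X \<and> card A = Suc l. p ^ cross (insert b X - A) A) = p ^ Suc l * ?S X (Suc l)"
        unfolding sum_distrib_left using c2 by (intro sum.cong) (simp_all only: mem_Collect_eq power_add)
      finally show ?thesis .
    qed
    let ?n = "card X"
    have card: "card (insert b X) = Suc ?n" using insert.hyps(1) bX by simp
    have l: "l \<le> ?n" using insert.prems Suc card by simp
    have 1: "?S X l * qpoch p l * qpoch p (?n - l) = qpoch p ?n" by (rule insert.IH[OF l])
    have 2: "?S X (Suc l) * qpoch p (Suc l) * qpoch p (?n - l) = qpoch p ?n * (1 - p ^ (?n - l))"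
    proof (cases "Suc l \<le> ?n")
      case True
      then have "?n - l = Suc (?n - Suc l)" by simp
      then have e: "qpoch p (?n - l) = qpoch p (?n - Suc l) * (1 - p ^ (?n - l))"
        by (metis qpoch_Suc)
      show ?thesis unfolding e by (simp only: insert.IH[OF True] flip: mult.assoc)
    \<comment> \<open>Here \<open>l = ?n\<close>: no subset of \<open>X\<close> is large enough, and
      the factor \<open>1 - p ^ 0\<close> makes the right side vanish as well.\<close>
    next
      case False
      then have "card A \<noteq> Suc l" if "A \<subseteq> X" for A
        using card_mono[OF insert.hyps(1) that] by simp
      then have "{A. A \<subseteq> X \<and> card A = Suc l} = {}" by blast
      then have S0: "?S X (Suc l) = 0" by (simp only: sum.empty)
      have "?n = l" using False l by simp
      then show ?thesis unfolding S0 by simp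
    qed
    have e: "p ^ Suc l * p ^ (?n - l) = p ^ Suc ?n"
      unfolding power_add[symmetric] using l by simp
    have alg1: "(s + t * u) * (x * v) * y = (s * x * y) * v + t * (u * (x * v) * y)"
      and alg2: "x * (1 - t) + t * (x * (1 - y)) = x * (1 - t * y)" for s t u v x y :: 'b
      by (simp_all add: algebra_simps)
    have "?S (insert b X) (Suc l) * qpoch p (Suc l) * qpoch p (?n - l)
       = (?S X l * qpoch p l * qpoch p (?n - l)) * (1 - p ^ Suc l)
         + p ^ Suc l * (?S X (Suc l) * qpoch p (Suc l) * qpoch p (?n - l))"
      unfolding rec qpoch_Suc[of p l] by (rule alg1)
    also have "\<dots> = qpoch p ?n * (1 - p ^ Suc l * p ^ (?n - l))"
      unfolding 1 2 by (rule alg2)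
    also have "\<dots> = qpoch p (Suc ?n)" unfolding e qpoch_Suc ..
    finally show ?thesis by (simp only: card Suc diff_Suc_Suc)
  qed
qed

section \<open>The joint generating function of \<open>rinv\<close> and \<open>rmaj\<close>\<close>

text \<open>A decreasing prefix is determined by its set \<open>A\<close> of letters, so such words
  correspond to pairs of \<open>A\<close> and an arbitrary arrangement of
  \<open>X - A\<close>.\<close>

lemma sum_decreasing_prefix:
  fixes p :: "'b::comm_ring_1" and X :: "'a::linorder set"
  assumes X: "finite X" and k: "k \<le> card X"
  shows "(\<Sum>w\<in>permutations_of_set X. if sorted_wrt (>) (take k w) then p ^ rinv w * f (drop k w) else 0)
       = (\<Sum>A | A \<subseteq> X \<and> card A = k. p ^ cross (X - A) A * (\<Sum>u\<in>permutations_of_set (X - A). p ^ rinv u * f u))"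
proof -
  let ?W = "{w \<in> permutations_of_set X. sorted_wrt (>) (take k w)}"
  let ?T = "SIGMA A:{A. A \<subseteq> X \<and> card A = k}. permutations_of_set (X - A)"
  let ?v = "\<lambda>A. rev (sorted_list_of_set A)"
  have v: "sorted_wrt (>) (?v A)" "set (?v A) = A" "length (?v A) = k" "distinct (?v A)"
    if "A \<subseteq> X" "card A = k" for A
    using that finite_subset[OF that(1) X] by (auto simp: sorted_wrt_rev)
  have len: "length w = card X" if "w \<in> permutations_of_set X" for w
    using that by (simp add: permutations_of_set_def distinct_card[symmetric])
  have uniq: "?v (set (take k w)) = take k w" if "w \<in> ?W" for w
  proof -
    have "sorted_wrt (<) (rev (take k w))" using that by (simp add: sorted_wrt_rev)
    then have "sorted_list_of_set (set (rev (take k w))) = rev (take k w)"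
      by (metis sorted_list_of_set.idem_if_sorted_distinct strict_sorted_iff)
    then show ?thesis by simp
  qed
  have "(\<Sum>w\<in>permutations_of_set X. if sorted_wrt (>) (take k w) then p ^ rinv w * f (drop k w) else 0)
     = (\<Sum>w\<in>?W. p ^ rinv w * f (drop k w))"
    by (rule sum.inter_filter[symmetric]) simp
  also have "\<dots> = (\<Sum>(A, u)\<in>?T. p ^ cross (X - A) A * (p ^ rinv u * f u))"
  proof (rule sum.reindex_bij_witness[where i = "\<lambda>(A, u). ?v A @ u" and j = "\<lambda>w. (set (take k w), drop k w)"], goal_cases)
    case (1 w)
    then show ?case using uniq[OF 1] by simp
  next
    case (2 w)
    have "distinct (take k w @ drop k w)" "set (take k w @ drop k w) = X"
      using 2 by (auto simp: permutations_of_set_def)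
    then have "set (take k w) \<inter> set (drop k w) = {}" "set (take k w) \<union> set (drop k w) = X"
      unfolding distinct_append set_append by auto
    moreover have "card (set (take k w)) = k"
      using 2 len[of w] k by (simp add: permutations_of_set_def distinct_card)
    ultimately show ?case using 2 by (auto simp: permutations_of_set_def)
  next
    case (3 b)
    then show ?case using v by (cases b) auto
  next
    case (4 b)
    then show ?case using v by (cases b) (auto simp: permutations_of_set_def)
  next
    case (5 w)
    have "distinct (take k w @ drop k w)" "set (take k w @ drop k w) = X"
      using 5 by (auto simp: permutations_of_set_def)
    then have "set (drop k w) = X - set (take k w)"
      unfolding distinct_append set_append by auto
    moreover have "rinv w = cross (set (drop k w)) (set (take k w)) + rinv (drop k w)"
      using rinv_append_decreasing[of "take k w" "drop k w"] 5 by simp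
    ultimately show ?case by (simp add: power_add mult_ac)
  qed
  also have "\<dots> = (\<Sum>A | A \<subseteq> X \<and> card A = k. p ^ cross (X - A) A * (\<Sum>u\<in>permutations_of_set (X - A). p ^ rinv u * f u))"
    unfolding sum_distrib_left using X by (subst sum.Sigma) auto
  finally show ?thesis .
qed

text \<open>The recursion for \<open>n > 0\<close> is the coefficient form of $g(z) = e(z)\, g(qz)$.\<close>

fun roselle :: "complex \<Rightarrow> complex \<Rightarrow> nat \<Rightarrow> complex" where
  "roselle p q n = (if n = 0 then 1
     else (\<Sum>i<n. q ^ i * roselle p q i / qpoch p (n - i)) / (1 - q ^ n))"

declare roselle.simps [simp del]

lemma qpoch_nonzero:
  fixes p :: complex
  assumes "\<And>k. k > 0 \<Longrightarrow> p ^ k \<noteq> 1"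
  shows "qpoch p n \<noteq> 0"
  using assms by (auto simp: qpoch_def)

text \<open>Expanding \<open>q ^ rmaj w\<close> by \<open>initial_run_sum\<close> and sorting the
  words by the set of letters in the prefix reduces the sum to smaller sets, which is the recursion
  of \<open>roselle\<close>. A general \<open>X\<close> is required because the induction passes to
  complements \<open>X - A\<close>.\<close>

lemma sum_permutations_of_set:
  fixes p q :: complex and X :: "'a::linorder set"
  assumes p: "\<And>k. k > 0 \<Longrightarrow> p ^ k \<noteq> 1" and q: "\<And>k. k > 0 \<Longrightarrow> q ^ k \<noteq> 1"
    and "finite X"
  shows "(\<Sum>w\<in>permutations_of_set X. p ^ rinv w * q ^ rmaj w)
       = qpoch p (card X) * qpoch q (card X) * roselle p q (card X)"
  using assms(3)
proof (induction "card X" arbitrary: X rule: less_induct)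
  case less
  let ?n = "card X"
  show ?case
  proof (cases "X = {}")
    case True
    then show ?thesis by (simp add: roselle.simps)
  next
    case False
    then have n: "?n > 0" using less.prems by (simp add: card_gt_0_iff)
    let ?c = "\<lambda>i. q ^ (?n - Suc i) * (\<Prod>j<i. 1 - q ^ (?n - Suc j))"
    let ?h = "\<lambda>i. q ^ i * roselle p q i / qpoch p (?n - i)"
    have len: "length w = ?n" if "w \<in> permutations_of_set X" for w
      using that by (simp add: permutations_of_set_def distinct_card[symmetric])
    have "(\<Sum>w\<in>permutations_of_set X. p ^ rinv w * q ^ rmaj w)
       = (\<Sum>w\<in>permutations_of_set X. \<Sum>i<?n.
            ?c i * (if sorted_wrt (>) (take (Suc i) w) then p ^ rinv w * q ^ rmaj (drop (Suc i) w) else 0))"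
    proof (rule sum.cong[OF refl])
      fix w assume w: "w \<in> permutations_of_set X"
      have "distinct w" "w \<noteq> []" using w False by (auto simp: permutations_of_set_def)
      from initial_run_sum[OF this, of q, symmetric]
      have e: "q ^ rmaj w = (\<Sum>i<?n. if sorted_wrt (>) (take (Suc i) w)
          then ?c i * q ^ rmaj (drop (Suc i) w) else 0)"
        unfolding len[OF w] .
      show "p ^ rinv w * q ^ rmaj w = (\<Sum>i<?n.
          ?c i * (if sorted_wrt (>) (take (Suc i) w) then p ^ rinv w * q ^ rmaj (drop (Suc i) w) else 0))"
        unfolding e sum_distrib_left by (intro sum.cong) (simp_all split: if_split)
    qed
    also have "\<dots> = (\<Sum>i<?n. ?c i * (\<Sum>w\<in>permutations_of_set X.
         if sorted_wrt (>) (take (Suc i) w) then p ^ rinv w * q ^ rmaj (drop (Suc i) w) else 0))"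
      by (subst sum.swap) (simp only: sum_distrib_left)
    also have "\<dots> = (\<Sum>i<?n. qpoch p ?n * qpoch q (?n - 1) * ?h (?n - Suc i))"
    proof (rule sum.cong[OF refl])
      fix i assume "i \<in> {..<?n}"
      then have i: "Suc i \<le> ?n" "i \<le> ?n - 1" by auto
      let ?m = "?n - Suc i"
      let ?S = "\<Sum>A | A \<subseteq> X \<and> card A = Suc i. p ^ cross (X - A) A"
      have "(\<Sum>w\<in>permutations_of_set X.
          if sorted_wrt (>) (take (Suc i) w) then p ^ rinv w * q ^ rmaj (drop (Suc i) w) else 0)
        = (\<Sum>A | A \<subseteq> X \<and> card A = Suc i. p ^ cross (X - A) A *
             (\<Sum>u\<in>permutations_of_set (X - A). p ^ rinv u * q ^ rmaj u))"
        by (rule sum_decreasing_prefix[OF less.prems i(1), where f = "\<lambda>u. q ^ rmaj u"])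
      also have "\<dots> = (\<Sum>A | A \<subseteq> X \<and> card A = Suc i. p ^ cross (X - A) A *
             (qpoch p ?m * qpoch q ?m * roselle p q ?m))"
      proof (rule sum.cong[OF refl], clarify)
        fix A assume A: "A \<subseteq> X" "card A = Suc i"
        then have c: "card (X - A) = ?m"
          using finite_subset[OF A(1) less.prems] by (simp add: card_Diff_subset)
        have "(\<Sum>u\<in>permutations_of_set (X - A). p ^ rinv u * q ^ rmaj u)
            = qpoch p ?m * qpoch q ?m * roselle p q ?m"
          using less.hyps[of "X - A"] less.prems c n by simp
        then show "p ^ cross (X - A) A * (\<Sum>u\<in>permutations_of_set (X - A). p ^ rinv u * q ^ rmaj u)
           = p ^ cross (X - A) A * (qpoch p ?m * qpoch q ?m * roselle p q ?m)" by simp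
      qed
      also have "\<dots> = ?S * qpoch p ?m * (qpoch q ?m * roselle p q ?m)"
        by (simp only: sum_distrib_right mult.assoc)
      also have "?S * qpoch p ?m = qpoch p ?n / qpoch p (Suc i)"
        using q_binomial_subsets[OF less.prems i(1), of p] qpoch_nonzero[OF p, of "Suc i"]
        by (simp add: field_simps)
      finally have 1: "(\<Sum>w\<in>permutations_of_set X.
          if sorted_wrt (>) (take (Suc i) w) then p ^ rinv w * q ^ rmaj (drop (Suc i) w) else 0)
        = qpoch p ?n / qpoch p (Suc i) * (qpoch q ?m * roselle p q ?m)" .
      \<comment> \<open>The product in the run weight completes the smaller q-Pochhammer symbol from
        the induction hypothesis to one that no longer depends on \<open>i\<close>.\<close>
      have 2: "(\<Prod>j<i. 1 - q ^ (?n - Suc j)) * qpoch q ?m = qpoch q (?n - 1)"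
        using qpoch_diff[OF i(2), of q] by simp
      have 3: "?n - ?m = Suc i" using i by simp
      show "?c i * (\<Sum>w\<in>permutations_of_set X.
          if sorted_wrt (>) (take (Suc i) w) then p ^ rinv w * q ^ rmaj (drop (Suc i) w) else 0)
        = qpoch p ?n * qpoch q (?n - 1) * ?h ?m"
        unfolding 1 3 2[symmetric] by (simp add: field_simps)
    qed
    also have "\<dots> = qpoch p ?n * qpoch q (?n - 1) * (\<Sum>i<?n. ?h i)"
      unfolding sum_distrib_left[symmetric] using sum.nat_diff_reindex[of ?h ?n] by (simp only:)
    \<comment> \<open>The recursion of \<open>roselle\<close> supplies exactly the factor missing
      from \<open>qpoch q (?n - 1)\<close>.\<close>
    also have "(\<Sum>i<?n. ?h i) = (1 - q ^ ?n) * roselle p q ?n"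
      using n q[OF n] roselle.simps[of p q ?n] by simp
    also have "qpoch p ?n * qpoch q (?n - 1) * \<dots> = qpoch p ?n * qpoch q ?n * roselle p q ?n"
      using qpoch_Suc[of q "?n - 1"] n by simp
    finally show ?thesis .
  qed
qed

section \<open>From permutations as functions to reversed words\<close>

text \<open>Passing to \<open>Suc n\<close> puts \<open>w (Suc n)\<close> at the head of the
  reversed word, and the new inversions are those ending at \<open>Suc n\<close>. Injectivity allows
  them to be counted by values, as \<open>rinv\<close> does, instead of positions.\<close>

lemma rinv_rev_map:
  assumes "inj w"
  shows "rinv (rev (map w [1..<Suc n])) = perm_inv n w"
proof (induction n)
  case 0
  then show ?case by (simp add: perm_inv_def)
next
  case (Suc n)
  have fin: "finite {(i, j). i \<in> {1..n} \<and> j \<in> {1..n} \<and> i < j \<and> w i > w j}"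
    by (rule finite_subset[of _ "{1..n} \<times> {1..n}"]) auto
  have "{(i, j). i \<in> {1..Suc n} \<and> j \<in> {1..Suc n} \<and> i < j \<and> w i > w j}
     = {(i, j). i \<in> {1..n} \<and> j \<in> {1..n} \<and> i < j \<and> w i > w j}
       \<union> (\<lambda>i. (i, Suc n)) ` {i \<in> {1..n}. w (Suc n) < w i}"
    by (auto simp: le_Suc_eq)
  moreover have "card ({(i, j). i \<in> {1..n} \<and> j \<in> {1..n} \<and> i < j \<and> w i > w j}
       \<union> (\<lambda>i. (i, Suc n)) ` {i \<in> {1..n}. w (Suc n) < w i})
     = perm_inv n w + card ((\<lambda>i. (i, Suc n)) ` {i \<in> {1..n}. w (Suc n) < w i})"
    unfolding perm_inv_def by (intro card_Un_disjoint fin) auto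
  ultimately have "perm_inv (Suc n) w = perm_inv n w + card ((\<lambda>i. (i, Suc n)) ` {i \<in> {1..n}. w (Suc n) < w i})"
    unfolding perm_inv_def by (simp only:)
  also have "card ((\<lambda>i. (i, Suc n)) ` {i \<in> {1..n}. w (Suc n) < w i}) = card {i \<in> {1..n}. w (Suc n) < w i}"
    by (rule card_image) (auto simp: inj_on_def)
  also have "\<dots> = card (w ` {i \<in> {1..n}. w (Suc n) < w i})"
    using assms by (intro card_image[symmetric]) (auto simp: inj_on_def)
  also have "w ` {i \<in> {1..n}. w (Suc n) < w i} = {y \<in> w ` {1..n}. w (Suc n) < y}"
    by auto
  finally have inv: "perm_inv (Suc n) w = perm_inv n w + card {y \<in> w ` {1..n}. w (Suc n) < y}" .
  have word: "rev (map w [1..<Suc (Suc n)]) = w (Suc n) # rev (map w [1..<Suc n])" by simp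
  have "set (rev (map w [1..<Suc n])) = w ` {1..n}"
    by (simp add: atLeastLessThanSuc_atLeastAtMost del: upt_Suc)
  then show ?case unfolding word rinv.simps Suc.IH inv by simp
qed

text \<open>The number of letters from \<open>y\<close> to the end of the reversed word is the
  position of \<open>y\<close> in the original word, hence the position of the descent.\<close>

lemma rmaj_rev_map: "rmaj (rev (map w [1..<Suc n])) = perm_maj n w"
proof (induction n)
  case 0
  then show ?case by (simp add: perm_maj_def)
next
  case (Suc n)
  show ?case
  proof (cases n)
    case 0
    then show ?thesis by (simp add: perm_maj_def)
  next
    case [simp]: (Suc m)
    have "{i. 1 \<le> i \<and> i < Suc n \<and> w i > w (i + 1)}
       = (if w (Suc n) < w n then insert n else id) {i. 1 \<le> i \<and> i < n \<and> w i > w (i + 1)}"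
      by (auto simp: less_Suc_eq)
    then have "perm_maj (Suc n) w = (if w (Suc n) < w n then n else 0) + perm_maj n w"
      unfolding perm_maj_def by simp
    then show ?thesis using Suc.IH by simp
  qed
qed

lemma H_eq_sum_permutations_of_set:
  "H n p q = (\<Sum>w\<in>permutations_of_set {1..n}. p ^ rinv w * q ^ rmaj w)"
proof -
  let ?f = "\<lambda>w :: nat \<Rightarrow> nat. rev (map w [1..<Suc n])"
  let ?P = "{w. w permutes {1..n}}"
  have inj: "inj_on ?f ?P"
  proof (rule inj_onI, rule ext)
    fix v w x assume v: "v \<in> ?P" and w: "w \<in> ?P" and eq: "?f v = ?f w"
    show "v x = w x"
    proof (cases "x \<in> {1..n}")
      case True
      then show ?thesis using eq by (auto simp: map_eq_conv simp del: upt_Suc)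
    next
      case False
      then show ?thesis using v w by (auto simp: permutes_def)
    qed
  qed
  have "?f ` ?P \<subseteq> permutations_of_set {1..n}"
  proof (rule image_subsetI)
    fix w assume "w \<in> ?P"
    then have w: "w permutes {1..n}" by simp
    have "w ` {1..n} = {1..n}" using w by (rule permutes_image)
    then show "?f w \<in> permutations_of_set {1..n}"
      using permutes_inj_on[OF w]
      by (intro permutations_of_setI)
        (auto simp: distinct_map atLeastLessThanSuc_atLeastAtMost simp del: upt_Suc)
  qed
  moreover have "card (?f ` ?P) = card (permutations_of_set {1..n})"
    unfolding card_image[OF inj] by (subst card_permutations[where n = n]) auto
  ultimately have img: "?f ` ?P = permutations_of_set {1..n}"
    by (intro card_subset_eq) simp_all
  show ?thesis
    unfolding H_def img[symmetric] sum.reindex[OF inj] o_def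
    by (intro sum.cong) (simp_all only: mem_Collect_eq rinv_rev_map[OF permutes_inj] rmaj_rev_map)
qed

section \<open>Newton's recursion by formal power series\<close>

unbundle no vec_syntax
unbundle fps_syntax

text \<open>The substitution of \<open>c * z\<close> for \<open>z\<close>, written as a composition
  so that multiplicativity follows from that of composition.\<close>

definition dilate :: "complex \<Rightarrow> complex fps \<Rightarrow> complex fps" where
  "dilate c f = f oo (fps_const c * fps_X)"

lemma dilate_nth [simp]: "dilate c f $ n = c ^ n * f $ n"
  by (simp add: dilate_def fps_compose_linear)

lemma dilate_mult: "dilate c (f * g) = dilate c f * dilate c g"
  unfolding dilate_def by (rule fps_compose_mult_distrib) simp

lemma fps_deriv_dilate: "fps_deriv (dilate c f) = fps_const c * dilate c (fps_deriv f)"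
  by (simp add: fps_eq_iff algebra_simps)

text \<open>\<open>D\<close> is the logarithmic derivative; the constant term 1 makes
  \<open>f\<close> invertible.\<close>

lemma ex_log_deriv:
  fixes f :: "complex fps"
  assumes "f $ 0 = 1"
  obtains D where "fps_deriv f = D * f"
proof
  show "fps_deriv f = (fps_deriv f * inverse f) * f"
    using assms by (simp add: mult.assoc inverse_mult_eq_1)
qed

text \<open>The functional equation \<open>(1 - z) * e(z) = e(p * z)\<close> has the logarithmic
  derivative \<open>D(z) - p * D(p * z) = 1 / (1 - z)\<close>, which determines each coefficient of
  \<open>D\<close>.\<close>

lemma deriv_q_exponential:
  fixes p :: complex
  assumes p: "\<And>k. k > 0 \<Longrightarrow> p ^ k \<noteq> 1"
  defines "e \<equiv> Abs_fps (\<lambda>n. 1 / qpoch p n)"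
  shows "fps_deriv e = Abs_fps (\<lambda>n. 1 / (1 - p ^ Suc n)) * e"
proof -
  have e0: "e $ 0 = 1" by (simp add: e_def)
  have e: "(1 - fps_X) * e = dilate p e"
  proof (rule fps_ext)
    fix n
    show "((1 - fps_X) * e) $ n = dilate p e $ n"
    proof (cases n)
      case (Suc m)
      have "1 / qpoch p (Suc m) - 1 / qpoch p m = p ^ Suc m / qpoch p (Suc m)"
        using qpoch_nonzero[OF p, of m] p[of "Suc m"] by (simp add: qpoch_Suc divide_simps)
      then show ?thesis using Suc by (simp add: e_def left_diff_distrib)
    qed (simp add: e0 left_diff_distrib)
  qed
  obtain D where D: "fps_deriv e = D * e" using ex_log_deriv[OF e0] .
  have "(1 - fps_X) * fps_deriv e - e = fps_const p * dilate p (fps_deriv e)"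
    using arg_cong[OF e, of fps_deriv] by (simp add: fps_deriv_dilate algebra_simps)
  then have "((1 - fps_X) * (D - fps_const p * dilate p D)) * e = 1 * e"
    unfolding D dilate_mult e[symmetric] by (simp add: algebra_simps)
  moreover have "e \<noteq> 0" using e0 by auto
  ultimately have *: "(1 - fps_X) * (D - fps_const p * dilate p D) = 1"
    using mult_right_cancel by blast
  \<comment> \<open>Multiplication by \<open>1 - fps_X\<close> takes differences of consecutive
    coefficients, so all coefficients equal the constant one.\<close>
  have "(D - fps_const p * dilate p D) $ n = 1" for n
  proof (induction n)
    case 0
    show ?case using arg_cong[OF *, of "\<lambda>f. f $ 0"] by (simp add: left_diff_distrib)
  next
    case (Suc n)
    then show ?case using arg_cong[OF *, of "\<lambda>f. f $ Suc n"] by (simp add: left_diff_distrib)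
  qed
  then have "D $ n = 1 / (1 - p ^ Suc n)" for n
    using p[of "Suc n"] by (simp add: divide_simps) (simp add: algebra_simps)
  then have "D = Abs_fps (\<lambda>n. 1 / (1 - p ^ Suc n))" by (simp add: fps_eq_iff)
  with D show ?thesis by simp
qed

text \<open>Taking logarithmic derivatives in \<open>g(z) = g(q * z) * e(z)\<close> gives
  \<open>D(z) = q * D(q * z) + L(z)\<close>. Its coefficients are formally the power sums of the
  variables \<open>p^a q^b\<close>, and the claim is the coefficient form of
  \<open>g' = D * g\<close>.\<close>

lemma roselle_newton:
  assumes p: "\<And>k. k > 0 \<Longrightarrow> p ^ k \<noteq> 1" and q: "\<And>k. k > 0 \<Longrightarrow> q ^ k \<noteq> 1"
  shows "of_nat (Suc n) * roselle p q (Suc n)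
       = (\<Sum>i\<le>n. roselle p q (n - i) / ((1 - p ^ Suc i) * (1 - q ^ Suc i)))"
proof -
  define g where "g = Abs_fps (roselle p q)"
  define e where "e = Abs_fps (\<lambda>n. 1 / qpoch p n)"
  define L where "L = Abs_fps (\<lambda>n. 1 / (1 - p ^ Suc n))"
  have L: "fps_deriv e = L * e"
    unfolding e_def L_def by (rule deriv_q_exponential[OF p])
  have g0: "g $ 0 = 1" by (simp add: g_def roselle.simps)
  have g: "g = dilate q g * e"
  proof (rule fps_ext)
    fix n
    show "g $ n = (dilate q g * e) $ n"
    proof (cases "n = 0")
      case False
      have "(dilate q g * e) $ n = (\<Sum>i\<le>n. q ^ i * roselle p q i / qpoch p (n - i))"
        by (simp add: fps_mult_nth g_def e_def atLeast0AtMost)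
      \<comment> \<open>The top term \<open>i = n\<close> of the Cauchy product is split off; the
        remaining terms are the recursion defining \<open>roselle p q n\<close>.\<close>
      also have "\<dots> = (\<Sum>i<n. q ^ i * roselle p q i / qpoch p (n - i)) + q ^ n * roselle p q n"
        by (simp flip: lessThan_Suc_atMost)
      also have "(\<Sum>i<n. q ^ i * roselle p q i / qpoch p (n - i)) = (1 - q ^ n) * roselle p q n"
        using False q[of n] roselle.simps[of p q n] by simp
      finally show ?thesis by (simp add: g_def algebra_simps)
    qed (simp add: g0 e_def)
  qed
  obtain D where D: "fps_deriv g = D * g" using ex_log_deriv[OF g0] .
  have "D * g = fps_deriv (dilate q g * e)" unfolding D[symmetric] using g by simp
  also have "\<dots> = (fps_const q * dilate q D + L) * (dilate q g * e)"
    by (simp add: fps_deriv_dilate D L dilate_mult algebra_simps)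
  also have "\<dots> = (fps_const q * dilate q D + L) * g" using g by simp
  finally have "D * g = (fps_const q * dilate q D + L) * g" .
  moreover have "g \<noteq> 0" using g0 by auto
  ultimately have "D = fps_const q * dilate q D + L" using mult_right_cancel by blast
  then have "D $ i = q ^ Suc i * D $ i + L $ i" for i
    by (metis dilate_nth fps_add_nth fps_mult_left_const_nth mult.assoc power_Suc)
  moreover have "d = 1 / ((1 - u) * (1 - v))" if "d = v * d + 1 / (1 - u)" "v \<noteq> 1" for d u v :: complex
  proof -
    have "(1 - v) * d = 1 / (1 - u)" using that(1) by (metis add_diff_cancel_left' left_diff_distrib mult_1)
    then show ?thesis using that(2) by (simp add: eq_divide_eq mult.commute flip: divide_divide_eq_left)
  qed
  ultimately have "D $ i = 1 / ((1 - p ^ Suc i) * (1 - q ^ Suc i))" for i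
    using q[of "Suc i"] by (simp only: L_def fps_nth_Abs_fps zero_less_Suc not_False_eq_True)
  moreover have "fps_deriv g $ n = (\<Sum>i\<le>n. D $ i * g $ (n - i))"
    unfolding D by (simp add: fps_mult_nth atLeast0AtMost)
  ultimately show ?thesis by (simp add: g_def)
qed

section \<open>The recursion for \<open>F\<close>\<close>

lemma q_fact_qpoch: "(1 - p) ^ n * q_fact n p = qpoch p n"
proof -
  have "qpoch p n = (\<Prod>c=1..n. (1 - p) * q_bracket c p)"
    unfolding qpoch_def q_bracket_def by (simp add: one_diff_power_eq)
  then show ?thesis by (simp add: prod.distrib q_fact_def)
qed

lemma F_eq_roselle:
  assumes p: "\<And>k. k > 0 \<Longrightarrow> p ^ k \<noteq> 1" and q: "\<And>k. k > 0 \<Longrightarrow> q ^ k \<noteq> 1"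
  shows "F n p q = fact n * ((1 - p) * (1 - q)) ^ n * roselle p q n"
proof -
  have "H n p q = qpoch p n * qpoch q n * roselle p q n"
    using sum_permutations_of_set[OF p q, of "{1..n}"] by (simp add: H_eq_sum_permutations_of_set)
  moreover have "q_fact n p \<noteq> 0" "q_fact n q \<noteq> 0"
    using qpoch_nonzero[OF p] qpoch_nonzero[OF q] by (metis mult_zero_right q_fact_qpoch)+
  ultimately show ?thesis
    unfolding F_def by (simp add: power_mult_distrib flip: q_fact_qpoch)
qed

lemma F_recursion_generic:
  assumes p: "\<And>k. k > 0 \<Longrightarrow> p ^ k \<noteq> 1" and q: "\<And>k. k > 0 \<Longrightarrow> q ^ k \<noteq> 1"
  shows "F (Suc n) p q = (\<Sum>i\<le>n. fact n / fact (n - i) * ((1 - p) * (1 - q)) ^ i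
           / (q_bracket (Suc i) p * q_bracket (Suc i) q) * F (n - i) p q)"
proof -
  define a where "a = (1 - p) * (1 - q)"
  have a: "a \<noteq> 0" using p[of 1] q[of 1] by (simp add: a_def)
  have newton: "of_nat (Suc n) * roselle p q (Suc n)
       = (\<Sum>i\<le>n. roselle p q (n - i) / ((1 - p ^ Suc i) * (1 - q ^ Suc i)))"
    by (rule roselle_newton) (use p q in auto)
  have "F (Suc n) p q = fact n * a ^ Suc n * (of_nat (Suc n) * roselle p q (Suc n))"
    by (simp only: F_eq_roselle[OF p q] a_def fact_Suc mult_ac)
  also have "\<dots> = (\<Sum>i\<le>n. fact n * a ^ Suc n * (roselle p q (n - i) / ((1 - p ^ Suc i) * (1 - q ^ Suc i))))"
    unfolding newton sum_distrib_left ..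
  also have "\<dots> = (\<Sum>i\<le>n. fact n / fact (n - i) * a ^ i
           / (q_bracket (Suc i) p * q_bracket (Suc i) q) * F (n - i) p q)"
  proof (rule sum.cong[OF refl])
    fix i assume "i \<in> {..n}"
    then have n: "Suc n = i + (n - i) + 1" by simp
    have "(1 - p ^ Suc i) * (1 - q ^ Suc i) = a * (q_bracket (Suc i) p * q_bracket (Suc i) q)"
      unfolding one_diff_power_eq q_bracket_def a_def by (simp only: mult_ac)
    \<comment> \<open>Of the \<open>n + 1\<close> factors \<open>a\<close>, \<open>n - i\<close> are
      absorbed by \<open>F (n - i)\<close>, one cancels against the denominators, and
      \<open>i\<close> remain.\<close>
    moreover have "a ^ Suc n = a ^ i * a ^ (n - i) * a"
      by (subst n) (simp only: power_add power_one_right)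
    ultimately show "fact n * a ^ Suc n * (roselle p q (n - i) / ((1 - p ^ Suc i) * (1 - q ^ Suc i)))
       = fact n / fact (n - i) * a ^ i / (q_bracket (Suc i) p * q_bracket (Suc i) q) * F (n - i) p q"
      using a by (simp add: F_eq_roselle[OF p q] flip: a_def)
  qed
  finally show ?thesis by (simp add: a_def)
qed

lemma q_fact_nonzero: 
  assumes "\<And>c. 1 \<le> c \<Longrightarrow> c \<le> n \<Longrightarrow> q_bracket c p \<noteq> 0"
  shows "q_fact n p \<noteq> 0"
  using assms by (auto simp: q_fact_def)

text \<open>The generic recursion excludes roots of unity, in particular \<open>p = 1\<close>, which
  occurs for \<open>s = 0\<close>. Shrinking both arguments by a real \<open>r < 1\<close> moves
  them into the open disc, where no positive power equals 1; the nonvanishing brackets make both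
  sides continuous as \<open>r\<close> tends to 1.\<close>

lemma F_recursion:
  assumes p: "cmod p \<le> 1" "\<And>c. 1 \<le> c \<Longrightarrow> c \<le> Suc n \<Longrightarrow> q_bracket c p \<noteq> 0"
    and q: "cmod q \<le> 1" "\<And>c. 1 \<le> c \<Longrightarrow> c \<le> Suc n \<Longrightarrow> q_bracket c q \<noteq> 0"
  shows "F (Suc n) p q = (\<Sum>i\<le>n. fact n / fact (n - i) * ((1 - p) * (1 - q)) ^ i
           / (q_bracket (Suc i) p * q_bracket (Suc i) q) * F (n - i) p q)"
proof -
  let ?R = "\<lambda>p q. \<Sum>i\<le>n. fact n / fact (n - i) * ((1 - p) * (1 - q)) ^ i
           / (q_bracket (Suc i) p * q_bracket (Suc i) q) * F (n - i) p q"
  have lim: "((\<lambda>r. of_real r * z) \<longlongrightarrow> z) (at_left 1)" for z :: complex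
    by (auto intro!: tendsto_eq_intros)
  have bracket: "((\<lambda>r. q_bracket c (of_real r * z)) \<longlongrightarrow> q_bracket c z) (at_left 1)" for c z
    unfolding q_bracket_def by (intro tendsto_intros lim)
  have F: "((\<lambda>r. F m (of_real r * p) (of_real r * q)) \<longlongrightarrow> F m p q) (at_left 1)" if "m \<le> Suc n" for m
  proof -
    have "q_fact m p \<noteq> 0" "q_fact m q \<noteq> 0" using that p(2) q(2) by (auto intro!: q_fact_nonzero)
    then show ?thesis unfolding F_def H_def
      unfolding q_fact_def by (intro tendsto_intros lim bracket) auto
  qed
  have R: "((\<lambda>r. ?R (of_real r * p) (of_real r * q)) \<longlongrightarrow> ?R p q) (at_left 1)"
    using p(2) q(2) by (intro tendsto_intros lim bracket F) auto
  have "\<forall>\<^sub>F r in at_left (1::real). r \<in> {0<..<1}"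
    by (rule eventually_at_left_1) simp
  then have "\<forall>\<^sub>F r in at_left 1. ?R (of_real r * p) (of_real r * q) = F (Suc n) (of_real r * p) (of_real r * q)"
  proof eventually_elim
    case (elim r)
    have not_root: "(of_real r * z) ^ k \<noteq> 1" if "cmod z \<le> 1" "k > 0" for z k
    proof -
      have "cmod (of_real r * z) = r * cmod z" using elim by (simp add: norm_mult)
      also have "\<dots> \<le> r" using elim that(1) by (intro mult_left_le) auto
      also have "\<dots> < 1" using elim by simp
      finally have "cmod (of_real r * z) < 1" .
      then have "cmod ((of_real r * z) ^ k) < 1"
        using that(2) by (simp add: norm_power power_less_one_iff)
      then show ?thesis by (metis less_irrefl norm_one)
    qed
    show ?case
      by (rule F_recursion_generic[symmetric]) (use not_root p(1) q(1) in auto)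
  qed
  with R have "((\<lambda>r. F (Suc n) (of_real r * p) (of_real r * q)) \<longlongrightarrow> ?R p q) (at_left 1)"
    by (rule Lim_transform_eventually)
  with F[OF le_refl] show ?thesis by (intro tendsto_unique[of "at_left (1::real)"]) auto
qed

section \<open>Estimates on the unit circle\<close>

lemma norm_power_minus_one_le:
  fixes z :: complex
  assumes "cmod z = 1"
  shows "cmod (z ^ k - 1) \<le> real k * cmod (z - 1)"
proof (induction k)
  case (Suc k)
  have "z ^ Suc k - 1 = z ^ k * (z - 1) + (z ^ k - 1)" by (simp add: algebra_simps)
  then have "cmod (z ^ Suc k - 1) \<le> cmod (z ^ k * (z - 1)) + cmod (z ^ k - 1)"
    by (metis norm_triangle_ineq)
  also have "cmod (z ^ k * (z - 1)) = cmod (z - 1)" using assms by (simp add: norm_mult norm_power)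
  finally show ?case using Suc by (simp add: algebra_simps)
qed simp

text \<open>Each of the \<open>c\<close> summands lies within 1/2 of 1, so the bracket lies within
  \<open>c / 2\<close> of \<open>c\<close>.\<close>

lemma norm_q_bracket_ge:
  fixes z :: complex
  assumes "cmod z = 1" "real c * cmod (z - 1) \<le> 1 / 2"
  shows "real c / 2 \<le> cmod (q_bracket c z)"
proof -
  have "cmod (\<Sum>k<c. z ^ k - 1) \<le> (\<Sum>k<c. 1 / 2)"
  proof (rule order_trans[OF norm_sum sum_mono])
    fix k assume "k \<in> {..<c}"
    then have "real k * cmod (z - 1) \<le> real c * cmod (z - 1)" by (intro mult_right_mono) auto
    then show "cmod (z ^ k - 1) \<le> 1 / 2"
      using norm_power_minus_one_le[OF assms(1), of k] assms(2) by linarith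
  qed
  then have "cmod (q_bracket c z - of_nat c) \<le> real c / 2"
    by (simp add: q_bracket_def sum_subtractf)
  moreover have "cmod (of_nat c :: complex) \<le> cmod (q_bracket c z) + cmod (q_bracket c z - of_nat c)"
    by (metis norm_minus_commute norm_triangle_sub add.commute)
  ultimately show ?thesis by simp
qed

lemma fact_quotient_le: "i \<le> n \<Longrightarrow> (fact n / fact (n - i) :: real) \<le> real n ^ i"
proof -
  assume i: "i \<le> n"
  have "real (fact n div fact (n - i)) \<le> real (n ^ i)"
    using fact_div_fact_le_pow[OF i] by (simp only: of_nat_le_iff)
  moreover have "(fact (n - i) :: nat) dvd fact n" by (intro fact_dvd) simp
  ultimately show ?thesis by (simp add: real_of_nat_div)
qed

text \<open>By the recursion, each step from \<open>F n\<close> to \<open>F (Suc n)\<close> changes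
  the value by at most \<open>4 * x\<close> with \<open>x = N * |a|\<close>. Keeping
  \<open>N\<close> fixed while \<open>m\<close> grows makes this bound uniform over all
  steps.\<close>

lemma norm_F_minus_one_le:
  fixes p q :: complex
  assumes p: "cmod p = 1" "real N * cmod (p - 1) \<le> 1 / 2"
    and q: "cmod q = 1" "real N * cmod (q - 1) \<le> 1 / 2"
    and small: "4 * real N ^ 2 * cmod ((1 - p) * (1 - q)) \<le> 1"
    and "m \<le> N"
  shows "cmod (F m p q - 1) \<le> 4 * real m * (real N * cmod ((1 - p) * (1 - q)))"
  using assms(6)
proof (induction m rule: less_induct)
  case (less m)
  define a where "a = (1 - p) * (1 - q)"
  define x where "x = real N * cmod a"
  have x0: "0 \<le> x" by (simp add: x_def)
  have br: "real c / 2 \<le> cmod (q_bracket c p)" "real c / 2 \<le> cmod (q_bracket c q)" if "c \<le> N" for c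
  proof -
    have "real c * cmod (z - 1) \<le> real N * cmod (z - 1)" for z :: complex
      using that by (intro mult_right_mono) auto
    then have "real c * cmod (p - 1) \<le> 1 / 2" "real c * cmod (q - 1) \<le> 1 / 2"
      using p(2) q(2) order_trans by blast+
    then show "real c / 2 \<le> cmod (q_bracket c p)" "real c / 2 \<le> cmod (q_bracket c q)"
      using norm_q_bracket_ge p(1) q(1) by blast+
  qed
  have nz: "q_bracket c p \<noteq> 0" "q_bracket c q \<noteq> 0" if "1 \<le> c" "c \<le> N" for c
    using br[OF that(2)] that(1) by auto
  show ?case
  proof (cases m)
    case 0
    have "F 0 p q = 1" by (simp add: F_def H_def q_fact_def perm_maj_def perm_inv_def)
    with 0 show ?thesis by simp
  next
    case (Suc n)
    have N: "1 \<le> real N" using less.prems Suc by simp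
    have Nx: "4 * (real N * x) \<le> 1" using small by (simp add: x_def a_def power2_eq_square mult.assoc)
    have "x \<le> real N * x" using N x0 by (simp add: mult_le_cancel_right1)
    then have x4: "4 * x \<le> 1" using Nx by simp
    let ?t = "\<lambda>i. fact n / fact (n - i) * a ^ i / (q_bracket (Suc i) p * q_bracket (Suc i) q) * F (n - i) p q"
    have "F (Suc n) p q = (\<Sum>i\<le>n. ?t i)"
      \<comment> \<open>The term \<open>i = 0\<close> is \<open>F n p q\<close> itself, since the
        bracket of 1 is 1; the rest of the sum is the error.\<close>
      unfolding a_def using less.prems Suc nz p(1) q(1) by (intro F_recursion) auto
    also have "\<dots> = F n p q + (\<Sum>i<n. ?t (Suc i))"
      by (simp add: q_bracket_def sum.atMost_shift del: sum.lessThan_Suc)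
    finally have diff: "F (Suc n) p q - 1 = (F n p q - 1) + (\<Sum>i<n. ?t (Suc i))" by simp
    \<comment> \<open>The induction hypothesis and \<open>small\<close> keep all earlier values
      within distance 1 of 1.\<close>
    have F2: "cmod (F j p q) \<le> 2" if "j \<le> n" for j
    proof -
      have "cmod (F j p q - 1) \<le> 4 * real j * x"
        using less.IH[of j] that less.prems Suc by (simp add: x_def a_def)
      also have "\<dots> = 4 * (real j * x)" by simp
      also have "\<dots> \<le> 4 * (real N * x)"
        using that less.prems Suc x0 by (intro mult_left_mono mult_right_mono) auto
      finally show ?thesis using Nx norm_triangle_sub[of "F j p q" 1] by simp
    qed
    \<comment> \<open>The factorial quotient and the power of \<open>a\<close> give
      \<open>x ^ Suc i\<close> with \<open>x \<le> 1 / 4\<close>; the brackets, of index at least 2,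
      have modulus at least 1, and \<open>F2\<close> contributes the factor 2.\<close>
    have t: "cmod (?t (Suc i)) \<le> 2 * x * (1 / 4) ^ i" if "i < n" for i
    proof -
      let ?u = "fact n / fact (n - Suc i) * a ^ Suc i / (q_bracket (Suc (Suc i)) p * q_bracket (Suc (Suc i)) q)"
      have c: "Suc (Suc i) \<le> N" using that less.prems Suc by simp
      have "1 \<le> cmod (q_bracket (Suc (Suc i)) p) * cmod (q_bracket (Suc (Suc i)) q)"
        using br[OF c] mult_mono[of 1 "cmod (q_bracket (Suc (Suc i)) p)" 1 "cmod (q_bracket (Suc (Suc i)) q)"] by simp
      then have d: "1 \<le> cmod (q_bracket (Suc (Suc i)) p * q_bracket (Suc (Suc i)) q)" by (simp add: norm_mult)
      have "fact n / fact (n - Suc i) \<le> real n ^ Suc i" using that by (intro fact_quotient_le) simp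
      also have "\<dots> \<le> real N ^ Suc i" using less.prems Suc by (intro power_mono) auto
      finally have f: "fact n / fact (n - Suc i) \<le> real N ^ Suc i" .
      have "cmod (fact n / fact (n - Suc i) * a ^ Suc i) = fact n / fact (n - Suc i) * cmod a ^ Suc i"
        by (simp add: norm_mult norm_divide norm_power)
      also have "\<dots> \<le> real N ^ Suc i * cmod a ^ Suc i" using f by (intro mult_right_mono) auto
      also have "\<dots> = x * x ^ i" by (simp add: x_def power_mult_distrib)
      also have "\<dots> \<le> x * (1 / 4) ^ i" using x0 x4 by (intro mult_left_mono power_mono) auto
      finally have "cmod (fact n / fact (n - Suc i) * a ^ Suc i) \<le> x * (1 / 4) ^ i" .
      then have "cmod (fact n / fact (n - Suc i) * a ^ Suc i)
            / cmod (q_bracket (Suc (Suc i)) p * q_bracket (Suc (Suc i)) q)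
          \<le> x * (1 / 4) ^ i / 1"
        using d x0 by (intro frac_le) auto
      then have u: "cmod ?u \<le> x * (1 / 4) ^ i"
        by (simp only: norm_divide div_by_1)
      have "cmod (?t (Suc i)) = cmod ?u * cmod (F (n - Suc i) p q)" by (rule norm_mult)
      also have "\<dots> \<le> x * (1 / 4) ^ i * 2"
        using F2[of "n - Suc i"] x0 u by (intro mult_mono) simp_all
      finally show ?thesis by (simp only: mult_ac)
    qed
    have "cmod (\<Sum>i<n. ?t (Suc i)) \<le> (\<Sum>i<n. 2 * x * (1 / 4) ^ i)"
      using t by (intro order_trans[OF norm_sum sum_mono]) auto
    \<comment> \<open>The geometric factor is at most 4/3; rounding it up to 2 yields the constant
      4.\<close>
    also have "\<dots> = 2 * x * ((1 - (1 / 4) ^ n) * (4 / 3))"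
      by (simp add: sum_distrib_left[symmetric] sum_gp_strict)
    also have "\<dots> \<le> 2 * x * 2"
    proof (rule mult_left_mono)
      have bound: "(1 - y) * (4 / 3) \<le> 2" if "0 \<le> y" for y :: real using that by simp
      show "(1 - (1 / 4) ^ n) * (4 / 3) \<le> (2 :: real)" by (rule bound) simp
    qed (use x0 in simp)
    finally have "cmod (\<Sum>i<n. ?t (Suc i)) \<le> 4 * x" by simp
    moreover have "cmod (F n p q - 1) \<le> 4 * real n * x"
      using less.IH[of n] less.prems Suc by (simp add: x_def a_def)
    moreover have "cmod (F (Suc n) p q - 1) \<le> cmod (F n p q - 1) + cmod (\<Sum>i<n. ?t (Suc i))"
      unfolding diff by (rule norm_triangle_ineq)
    ultimately have "cmod (F m p q - 1) \<le> 4 * real m * x" using Suc by (simp add: algebra_simps)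
    then show ?thesis by (simp add: x_def a_def)
  qed
qed

text \<open>The chord has length \<open>2 * |sin (x / 2)|\<close>.\<close>

lemma norm_exp_i_minus_one_le: "cmod (exp (\<i> * of_real x) - 1) \<le> \<bar>x\<bar>"
  using abs_sin_x_le_abs_x[of "x / 2"] by (simp add: dist_exp_i_1)

section \<open>The uniform limit\<close>

theorem theorem3p1:
  fixes K :: "(real \<times> real) set"
  assumes "compact K"
  shows "uniform_limit K
           (\<lambda>n (s, t). F n (exp (\<i> * of_real (s / stddev n))) (exp (\<i> * of_real (t / stddev n))))
           (\<lambda>_. 1) sequentially"
proof -
  obtain B where B: "\<And>z. z \<in> K \<Longrightarrow> norm z \<le> B" and "B > 0"
    using compact_imp_bounded[OF assms] bounded_pos by metis
  \<comment> \<open>\<open>stddev n\<close> grows like a constant times \<open>n\<close> to the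
    power 3/2.\<close>
  have lim1: "(\<lambda>n. real n * (B / stddev n)) \<longlonglongrightarrow> 0"
    unfolding stddev_def by real_asymp
  have "(\<lambda>n. 4 * (real n * (B / stddev n)) ^ 2) \<longlonglongrightarrow> 4 * 0 ^ 2"
    by (intro tendsto_intros lim1)
  then have lim2: "(\<lambda>n. 4 * real n ^ 2 * (B / stddev n) ^ 2) \<longlonglongrightarrow> 0"
    by (simp only: power_mult_distrib mult.assoc power_zero_numeral mult_zero_right)
  show ?thesis
  proof (rule uniform_limitI)
    fix e :: real assume "e > 0"
    have "\<forall>\<^sub>F n in sequentially. real n * (B / stddev n) < 1 / 2"
      by (rule order_tendstoD(2)[OF lim1]) simp
    \<comment> \<open>The bound 1 provides the hypothesis \<open>small\<close> of
      \<open>norm_F_minus_one_le\<close>, and \<open>e\<close> the final estimate, both with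
      \<open>N = n\<close>.\<close>
    moreover have "\<forall>\<^sub>F n in sequentially. 4 * real n ^ 2 * (B / stddev n) ^ 2 < min 1 e"
      by (rule order_tendstoD(2)[OF lim2]) (use \<open>e > 0\<close> in simp)
    ultimately show "\<forall>\<^sub>F n in sequentially. \<forall>z\<in>K. dist (case z of (s, t) \<Rightarrow>
        F n (exp (\<i> * of_real (s / stddev n))) (exp (\<i> * of_real (t / stddev n)))) 1 < e"
    proof eventually_elim
      case (elim n)
      show ?case
      proof (clarify)
        fix s t assume st: "(s, t) \<in> K"
        let ?p = "exp (\<i> * of_real (s / stddev n))" and ?q = "exp (\<i> * of_real (t / stddev n))"
        let ?b = "B / stddev n"
        \<comment> \<open>This makes the radicand nonnegative for every \<open>n\<close>. For
          \<open>n \<le> 1\<close> the deviation is 0 and quotients by it are 0, so the bounds below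
          still hold.\<close>
        have "real n \<le> real n ^ k" if "k > 0" for k
          using that by (cases "n = 0") (auto intro: self_le_power)
        from this[of 2] this[of 3] have "0 \<le> 2 * real n ^ 3 + 3 * real n ^ 2 - 5 * real n" by linarith
        then have "0 \<le> stddev n" unfolding stddev_def by simp
        have "\<bar>s\<bar> \<le> B" "\<bar>t\<bar> \<le> B"
          using B[OF st] norm_fst_le[of s t] norm_snd_le[of t s] by auto
        then have "\<bar>s / stddev n\<bar> \<le> ?b" "\<bar>t / stddev n\<bar> \<le> ?b"
          using \<open>0 \<le> stddev n\<close> by (auto simp: abs_divide intro!: divide_right_mono)
        then have b: "cmod (?p - 1) \<le> ?b" "cmod (?q - 1) \<le> ?b"
          using norm_exp_i_minus_one_le order_trans by blast+
        then have "cmod (?p - 1) * cmod (?q - 1) \<le> ?b * ?b"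
          by (intro mult_mono) (auto intro: order_trans[OF norm_ge_zero])
        then have ab: "cmod ((1 - ?p) * (1 - ?q)) \<le> ?b ^ 2"
          by (simp add: norm_mult norm_minus_commute power2_eq_square)
        have nb: "4 * real n ^ 2 * cmod ((1 - ?p) * (1 - ?q)) \<le> 4 * real n ^ 2 * ?b ^ 2"
          by (intro mult_left_mono ab) simp
        have "real n * cmod (?p - 1) \<le> 1 / 2" "real n * cmod (?q - 1) \<le> 1 / 2"
          using mult_left_mono[OF b(1), of "real n"] mult_left_mono[OF b(2), of "real n"] elim(1) by linarith+
        then have "cmod (F n ?p ?q - 1) \<le> 4 * real n * (real n * cmod ((1 - ?p) * (1 - ?q)))"
          using nb elim(2) by (intro norm_F_minus_one_le) auto
        also have "\<dots> \<le> 4 * real n ^ 2 * ?b ^ 2"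
          using nb by (simp add: power2_eq_square mult.assoc)
        also have "\<dots> < e" using elim(2) by simp
        finally show "dist (F n ?p ?q) 1 < e" by (simp add: dist_norm)
      qed
    qed
  qed
qed

end
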